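(* Let $S$ be a commutative semiring with $1\neq 0$, let $M$ be a unital $S$-semimodule, and let $N$ be a proper subsemimodule of $M$. Then the following statements are equivalent: (1) $N$ is a $1$-absorbing prime subsemimodule of $M$. (2) For all nonunits $a,b\in S$ with $ab\notin (N:_S M)$, $(N:_M ab)\subseteq N$. (3) For all nonunits $a,b\in S$ and every subsemimodule $K$ of $M$ with $abK\subseteq N$, either $ab\in (N:_S M)$ or $K\subseteq N$. (4) For all proper ideals $I,J$ of $S$ and every subsemimodule $K$ of $M$ with $IJK\subseteq N$, either $IJ\subseteq (N:_S M)$ or $K\subseteq N$.
   Context: For a subsemimodule $N$ of $M$, $(N:_S M)=\{s\in S\mid sM\subseteq N\}$, an ideal of $S$. For $c\in S$, $(N:_M c)=\{m\in M\mid cm\in N\}$. A proper subsemimodule $N$ of $M$ is $1$-absorbing prime if for all nonunits $a,b\in S$ and all $m\in M$, $abm\in N$ implies $ab\in (N:_S M)$ or $m\in N$. Products such as $IJ$ and $IJK$ denote the ideal, respectively subsemimodule, of finite sums of products of elements. *)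

theory Defs
  imports Main
begin

(* The library's module locale asks for a ring acting on an abelian group, so semimodules
   over a semiring are introduced here in the same style: scalars and vectors are whole types. *)
locale semimodule =
  fixes scale :: "'s::comm_semiring_1 \<Rightarrow> 'm::comm_monoid_add \<Rightarrow> 'm"
  assumes scale_right_distrib: "scale a (x + y) = scale a x + scale a y"
    and scale_left_distrib: "scale (a + b) x = scale a x + scale b x"
    and scale_scale: "scale a (scale b x) = scale (a * b) x"
    and scale_one: "scale 1 x = x"
    and scale_zero_left: "scale 0 x = 0"
    and scale_zero_right: "scale a 0 = 0"

definition subsemimodule ::
  "('s::comm_semiring_1 \<Rightarrow> 'm::comm_monoid_add \<Rightarrow> 'm) \<Rightarrow> 'm set \<Rightarrow> bool" where
  "subsemimodule scale N \<longleftrightarrow>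
     0 \<in> N \<and> (\<forall>x\<in>N. \<forall>y\<in>N. x + y \<in> N) \<and> (\<forall>s. \<forall>x\<in>N. scale s x \<in> N)"

definition proper_subsemimodule ::
  "('s::comm_semiring_1 \<Rightarrow> 'm::comm_monoid_add \<Rightarrow> 'm) \<Rightarrow> 'm set \<Rightarrow> bool" where
  "proper_subsemimodule scale N \<longleftrightarrow> subsemimodule scale N \<and> N \<noteq> UNIV"

definition semiring_ideal :: "'s::comm_semiring_1 set \<Rightarrow> bool" where
  "semiring_ideal I \<longleftrightarrow>
     0 \<in> I \<and> (\<forall>a\<in>I. \<forall>b\<in>I. a + b \<in> I) \<and> (\<forall>s. \<forall>a\<in>I. s * a \<in> I)"

definition proper_ideal :: "'s::comm_semiring_1 set \<Rightarrow> bool" where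
  "proper_ideal I \<longleftrightarrow> semiring_ideal I \<and> I \<noteq> UNIV"

(* (N :_S M) *)
definition scalar_colon ::
  "('s::comm_semiring_1 \<Rightarrow> 'm::comm_monoid_add \<Rightarrow> 'm) \<Rightarrow> 'm set \<Rightarrow> 's set" where
  "scalar_colon scale N = {s. range (scale s) \<subseteq> N}"

(* (N :_M c) *)
definition vector_colon ::
  "('s::comm_semiring_1 \<Rightarrow> 'm::comm_monoid_add \<Rightarrow> 'm) \<Rightarrow> 'm set \<Rightarrow> 's \<Rightarrow> 'm set" where
  "vector_colon scale N c = {m. scale c m \<in> N}"

definition ideal_prod :: "'s::comm_semiring_1 set \<Rightarrow> 's set \<Rightarrow> 's set" where
  "ideal_prod I J =
     {\<Sum>i<n. a i * b i | (n::nat) a b. \<forall>i<n. a i \<in> I \<and> b i \<in> J}"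

(* The product IJK is ideal_scale scale (ideal_prod I J) K. *)
definition ideal_scale ::
  "('s::comm_semiring_1 \<Rightarrow> 'm::comm_monoid_add \<Rightarrow> 'm) \<Rightarrow> 's set \<Rightarrow> 'm set \<Rightarrow> 'm set" where
  "ideal_scale scale I K =
     {\<Sum>i<n. scale (a i) (x i) | (n::nat) a x. \<forall>i<n. a i \<in> I \<and> x i \<in> K}"

(* a is a nonunit iff it does not divide 1; is_unit itself is only available in semidomains. *)
definition one_absorbing_prime ::
  "('s::comm_semiring_1 \<Rightarrow> 'm::comm_monoid_add \<Rightarrow> 'm) \<Rightarrow> 'm set \<Rightarrow> bool" where
  "one_absorbing_prime scale N \<longleftrightarrow> proper_subsemimodule scale N \<and>
     (\<forall>a b m. \<not> a dvd 1 \<longrightarrow> \<not> b dvd 1 \<longrightarrow> scale (a * b) m \<in> N \<longrightarrow>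
        a * b \<in> scalar_colon scale N \<or> m \<in> N)"

end

theory Submission
  imports Defs
begin

text \<open>
  The definition of a 1-absorbing prime subsemimodule compares single elements \<open>a\<close>, \<open>b\<close>, \<open>m\<close>; the
  other conditions compare ideals and subsemimodules. The two levels are linked in both directions.

  From elements to ideals: since \<open>N\<close> and \<open>(N :\<^sub>S M)\<close> are closed under sums, a product of ideals or
  subsemimodules lies in one of them as soon as all the generating products do (lemma
  \<open>ideal_scale_subset_iff\<close>). Elements of proper ideals are nonunits, so if some
  \<open>m \<in> K\<close> lies outside \<open>N\<close>, the elementwise condition puts \<open>ab\<close> into \<open>(N :\<^sub>S M)\<close> for all
  \<open>a \<in> I\<close> and \<open>b \<in> J\<close>.

  From ideals to elements: apply the condition to the cyclic objects \<open>Sa\<close>, \<open>Sb\<close> and \<open>Sm\<close>. A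
  principal ideal generated by a nonunit is proper, and \<open>abm \<in> N\<close> puts the
  whole product \<open>(Sa)(Sb)(Sm)\<close> into \<open>N\<close> because \<open>S\<close> is commutative.

  The semiring is a semimodule over itself, with ideals as subsemimodules and the product of ideals
  as a special case of the product of an ideal and a subsemimodule. So one lemma about semimodules
  covers both kinds of product.
\<close>

lemma semimodule_times: "semimodule ((*) :: 's::comm_semiring_1 \<Rightarrow> 's \<Rightarrow> 's)"
  by unfold_locales (simp_all add: algebra_simps)

lemma semiring_ideal_iff_subsemimodule: "semiring_ideal I \<longleftrightarrow> subsemimodule (*) I"
  by (simp add: semiring_ideal_def subsemimodule_def)

lemma ideal_prod_eq_ideal_scale: "ideal_prod I J = ideal_scale (*) I J"
  by (simp add: ideal_prod_def ideal_scale_def)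

lemma subsemimodule_sum:
  assumes "subsemimodule scale N" and "\<And>i. i < (n::nat) \<Longrightarrow> f i \<in> N"
  shows "(\<Sum>i<n. f i) \<in> N"
  using assms(2)
proof (induction n)
  case 0
  then show ?case using assms(1) by (simp add: subsemimodule_def)
next
  case (Suc n)
  then show ?case using assms(1) by (simp add: subsemimodule_def)
qed

lemma scale_in_ideal_scale:
  assumes "a \<in> I" and "x \<in> K"
  shows "scale a x \<in> ideal_scale scale I K"
proof -
  have "scale a x = (\<Sum>i<(1::nat). scale a x)" by simp
  then show ?thesis
    unfolding ideal_scale_def using assms
    by (intro CollectI exI[of _ "1::nat"] exI[of _ "\<lambda>_. a"] exI[of _ "\<lambda>_. x"]) auto
qed

text \<open>The elements of \<open>IK\<close> are sums of products, and \<open>N\<close> is closed under sums.\<close>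

lemma ideal_scale_subset_iff:
  assumes "subsemimodule scale N"
  shows "ideal_scale scale I K \<subseteq> N \<longleftrightarrow> (\<forall>a\<in>I. \<forall>x\<in>K. scale a x \<in> N)"
proof
  assume "ideal_scale scale I K \<subseteq> N"
  then show "\<forall>a\<in>I. \<forall>x\<in>K. scale a x \<in> N" using scale_in_ideal_scale by blast
next
  assume "\<forall>a\<in>I. \<forall>x\<in>K. scale a x \<in> N"
  then show "ideal_scale scale I K \<subseteq> N"
    unfolding ideal_scale_def by (auto intro!: subsemimodule_sum[OF assms])
qed

lemma ideal_prod_subset_iff:
  assumes "semiring_ideal L"
  shows "ideal_prod I J \<subseteq> L \<longleftrightarrow> (\<forall>a\<in>I. \<forall>b\<in>J. a * b \<in> L)"
  using ideal_scale_subset_iff[of "(*)" L I J] assms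
  by (simp add: ideal_prod_eq_ideal_scale semiring_ideal_iff_subsemimodule)

lemma (in semimodule) semiring_ideal_vector_preimage:
  assumes "subsemimodule scale N"
  shows "semiring_ideal {s. scale s m \<in> N}"
  using assms unfolding semiring_ideal_def subsemimodule_def
  by (auto simp: scale_zero_left scale_left_distrib scale_scale[symmetric])

lemma (in semimodule) semiring_ideal_scalar_colon:
  assumes "subsemimodule scale N"
  shows "semiring_ideal (scalar_colon scale N)"
  using semiring_ideal_vector_preimage[OF assms]
  unfolding semiring_ideal_def scalar_colon_def by blast

lemma (in semimodule) subsemimodule_cyclic: "subsemimodule scale (range (\<lambda>s. scale s m))"
  unfolding subsemimodule_def
proof (intro conjI ballI allI)
  show "0 \<in> range (\<lambda>s. scale s m)" by (rule range_eqI[of _ _ 0]) (simp add: scale_zero_left)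
next
  fix x y assume "x \<in> range (\<lambda>s. scale s m)" "y \<in> range (\<lambda>s. scale s m)"
  then show "x + y \<in> range (\<lambda>s. scale s m)" by (auto simp: scale_left_distrib[symmetric])
next
  fix s x assume "x \<in> range (\<lambda>s. scale s m)"
  then show "scale s x \<in> range (\<lambda>s. scale s m)" by (auto simp: scale_scale)
qed

lemma (in semimodule) generator_in_cyclic: "m \<in> range (\<lambda>s. scale s m)"
  by (rule range_eqI[of _ _ 1]) (simp add: scale_one)

lemma proper_ideal_principal:
  assumes "\<not> a dvd (1::'s::comm_semiring_1)"
  shows "proper_ideal (range (\<lambda>s. s * a))"
proof -
  have "1 \<notin> range (\<lambda>s. s * a)"
    using assms by (metis dvd_triv_right imageE)
  then show ?thesis
    using semimodule.subsemimodule_cyclic[OF semimodule_times, of a]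
    by (auto simp: proper_ideal_def semiring_ideal_iff_subsemimodule)
qed

lemma proper_ideal_nonunit:
  assumes "proper_ideal I" and "a \<in> I"
  shows "\<not> a dvd 1"
proof
  assume "a dvd 1"
  then obtain u where u: "1 = u * a" by (metis dvdE mult.commute)
  have "s \<in> I" for s
  proof -
    have "s = (s * u) * a" using u by (metis mult.assoc mult.right_neutral)
    then show ?thesis using assms by (metis proper_ideal_def semiring_ideal_def)
  qed
  then show False using assms(1) by (auto simp: proper_ideal_def)
qed

lemma one_absorbing_primeD_subset:
  assumes "one_absorbing_prime scale N" "\<not> a dvd 1" "\<not> b dvd 1"
    and "scale (a * b) ` K \<subseteq> N" "\<not> K \<subseteq> N"
  shows "a * b \<in> scalar_colon scale N"
  using assms unfolding one_absorbing_prime_def by blast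

text \<open>One \<open>m \<in> K - N\<close> witnesses \<open>ab \<in> (N :\<^sub>S M)\<close> for all generating products \<open>ab\<close> of \<open>IJ\<close> at once.\<close>

lemma (in semimodule) one_absorbing_primeD_ideals:
  assumes prime: "one_absorbing_prime scale N" and "proper_ideal I" "proper_ideal J"
    and prod: "ideal_scale scale (ideal_prod I J) K \<subseteq> N" and "\<not> K \<subseteq> N"
  shows "ideal_prod I J \<subseteq> scalar_colon scale N"
proof -
  have N: "subsemimodule scale N"
    using prime by (simp add: one_absorbing_prime_def proper_subsemimodule_def)
  have "a * b \<in> scalar_colon scale N" if "a \<in> I" "b \<in> J" for a b
  proof (rule one_absorbing_primeD_subset[OF prime])
    show "\<not> a dvd 1" "\<not> b dvd 1" using assms that by (auto dest: proper_ideal_nonunit)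
    have "a * b \<in> ideal_prod I J"
      using that by (simp add: ideal_prod_eq_ideal_scale scale_in_ideal_scale)
    then show "scale (a * b) ` K \<subseteq> N" using prod ideal_scale_subset_iff[OF N] by blast
  qed fact
  then show ?thesis by (simp add: ideal_prod_subset_iff[OF semiring_ideal_scalar_colon[OF N]])
qed

lemma (in semimodule) scale_cyclic_subset:
  assumes "subsemimodule scale N" and "scale c m \<in> N"
  shows "scale c ` range (\<lambda>s. scale s m) \<subseteq> N"
proof (clarify)
  fix s
  have "scale c (scale s m) = scale s (scale c m)" by (simp add: scale_scale mult.commute)
  then show "scale c (scale s m) \<in> N" using assms by (simp add: subsemimodule_def)
qed

text \<open>
  The scalars that carry \<open>m\<close> into \<open>N\<close> form an ideal. It contains \<open>ab\<close>, hence every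
  generating product \<open>(sa)(tb)\<close>, and therefore all of \<open>(Sa)(Sb)\<close>.
\<close>

lemma (in semimodule) ideal_scale_principal_subset:
  assumes N: "subsemimodule scale N" and m: "scale (a * b) m \<in> N"
  shows "ideal_scale scale (ideal_prod (range (\<lambda>s. s * a)) (range (\<lambda>s. s * b)))
           (range (\<lambda>s. scale s m)) \<subseteq> N"
proof -
  let ?L = "{s. scale s m \<in> N}"
  have L: "semiring_ideal ?L" by (rule semiring_ideal_vector_preimage[OF N])
  have "(s * a) * (t * b) \<in> ?L" for s t
  proof -
    have "(s * a) * (t * b) = (s * t) * (a * b)" by (simp add: ac_simps)
    then show ?thesis using L m unfolding semiring_ideal_def by simp
  qed
  then have "ideal_prod (range (\<lambda>s. s * a)) (range (\<lambda>s. s * b)) \<subseteq> ?L"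
    by (auto simp: ideal_prod_subset_iff[OF L])
  then show ?thesis
    unfolding ideal_scale_subset_iff[OF N] using scale_cyclic_subset[OF N] by blast
qed

theorem theorem2p8:
  fixes scale :: "'s::comm_semiring_1 \<Rightarrow> 'm::comm_monoid_add \<Rightarrow> 'm"
    and N :: "'m set"
  assumes "semimodule scale"
    and "proper_subsemimodule scale N"
  shows
    "(one_absorbing_prime scale N \<longleftrightarrow>
       (\<forall>a b. \<not> a dvd 1 \<longrightarrow> \<not> b dvd 1 \<longrightarrow> a * b \<notin> scalar_colon scale N \<longrightarrow>
          vector_colon scale N (a * b) \<subseteq> N))
     \<and> (one_absorbing_prime scale N \<longleftrightarrow>
       (\<forall>a b K. \<not> a dvd 1 \<longrightarrow> \<not> b dvd 1 \<longrightarrow> subsemimodule scale K \<longrightarrow>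
          scale (a * b) ` K \<subseteq> N \<longrightarrow> a * b \<in> scalar_colon scale N \<or> K \<subseteq> N))
     \<and> (one_absorbing_prime scale N \<longleftrightarrow>
       (\<forall>I J K. proper_ideal I \<longrightarrow> proper_ideal J \<longrightarrow> subsemimodule scale K \<longrightarrow>
          ideal_scale scale (ideal_prod I J) K \<subseteq> N \<longrightarrow>
          ideal_prod I J \<subseteq> scalar_colon scale N \<or> K \<subseteq> N))"
proof -
  interpret semimodule scale by fact
  have N: "subsemimodule scale N" using assms(2) by (simp add: proper_subsemimodule_def)
  have two: "one_absorbing_prime scale N \<longleftrightarrow>
       (\<forall>a b. \<not> a dvd 1 \<longrightarrow> \<not> b dvd 1 \<longrightarrow> a * b \<notin> scalar_colon scale N \<longrightarrow>
          vector_colon scale N (a * b) \<subseteq> N)"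
    using assms(2) unfolding one_absorbing_prime_def vector_colon_def by blast
  have three: "one_absorbing_prime scale N \<longleftrightarrow>
       (\<forall>a b K. \<not> a dvd 1 \<longrightarrow> \<not> b dvd 1 \<longrightarrow> subsemimodule scale K \<longrightarrow>
          scale (a * b) ` K \<subseteq> N \<longrightarrow> a * b \<in> scalar_colon scale N \<or> K \<subseteq> N)" (is "_ \<longleftrightarrow> ?three")
  proof
    assume "one_absorbing_prime scale N"
    then show ?three using one_absorbing_primeD_subset by blast
  next
    assume ?three
    then have "a * b \<in> scalar_colon scale N \<or> range (\<lambda>s. scale s m) \<subseteq> N"
      if "\<not> a dvd 1" "\<not> b dvd 1" "scale (a * b) m \<in> N" for a b m
      using that subsemimodule_cyclic[of m] scale_cyclic_subset[OF N] by blast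
    then show "one_absorbing_prime scale N"
      unfolding one_absorbing_prime_def using assms(2) generator_in_cyclic by blast
  qed
  have four: "one_absorbing_prime scale N \<longleftrightarrow>
       (\<forall>I J K. proper_ideal I \<longrightarrow> proper_ideal J \<longrightarrow> subsemimodule scale K \<longrightarrow>
          ideal_scale scale (ideal_prod I J) K \<subseteq> N \<longrightarrow>
          ideal_prod I J \<subseteq> scalar_colon scale N \<or> K \<subseteq> N)" (is "_ \<longleftrightarrow> ?four")
  proof
    assume "one_absorbing_prime scale N"
    then show ?four using one_absorbing_primeD_ideals by blast
  next
    assume four: ?four
    have "a * b \<in> scalar_colon scale N \<or> m \<in> N"
      if nonunit: "\<not> a dvd 1" "\<not> b dvd 1" and m: "scale (a * b) m \<in> N" for a b m
    proof -
      let ?I = "range (\<lambda>s. s * a)" and ?J = "range (\<lambda>s. s * b)" and ?K = "range (\<lambda>s. scale s m)"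
      have "ideal_prod ?I ?J \<subseteq> scalar_colon scale N \<or> ?K \<subseteq> N"
        using four nonunit[THEN proper_ideal_principal] subsemimodule_cyclic[of m]
          ideal_scale_principal_subset[OF N m] by blast
      moreover have "a * b \<in> ideal_prod ?I ?J"
        unfolding ideal_prod_eq_ideal_scale
        by (intro scale_in_ideal_scale semimodule.generator_in_cyclic semimodule_times)
      ultimately show ?thesis using generator_in_cyclic[of m] by blast
    qed
    then show "one_absorbing_prime scale N"
      unfolding one_absorbing_prime_def using assms(2) by blast
  qed
  from two three four show ?thesis by blast
qed

end
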